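(* Let $N\subseteq\mathbb{Z}^2$ be a finite-index sublattice, let $A_N=\mathbb{Z}^2/N$, and let $G_N=A_N\rtimes C_2$ with $C_2$ acting by $x\mapsto -x$. Let $v_1,v_2\in A_N$ be the images of the standard basis vectors of $\mathbb{Z}^2$, and let $S=(s_1,s_2,s_3)$ be the cubic honeycomb generating tuple, i.e. a tuple of three distinct elements with underlying set $\{(v_1,1),(v_1+v_2,1),(v_2,1)\}$. Put $t=s_1s_2$, let $m$ be the order of $t$, and let $2\leq k\leq m$. Let $q\ge 2$ and suppose that the pattern \[ Y_k=\{1,t,\ldots,t^{k-1}\} \] is separating for some labelling $G_N\to[q]$. Then \[ \widetilde Y_k=Y_k\cup\{t^js_1:0\leq j\leq k-2\}\cup S \] is a connected separating Cayley window (that is, it is a Cayley window of $\operatorname{Cay}(G_N,S)$ and it is separating for some labelling $G_N\to[q]$). In particular, \[ \operatorname{csep}_q(G_N,S)\leq 2k+1 . \]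
   Context: Group law: $G_N=A_N\rtimes C_2$ consists of pairs $(x,\epsilon)$ with $x\in A_N$, $\epsilon\in\{0,1\}$ (second coordinate modulo $2$), with $(x,\epsilon)(y,\delta)=(x+(-1)^\epsilon y,\epsilon+\delta)$; $1$ denotes the identity $(0,0)$. For an integer $q\geq 2$ write $[q]=\{0,1,\ldots,q-1\}$. For a finite group $G$, a labelling is a map $f:G\to[q]$, and a pattern is an ordered tuple $Y=(y_1,\ldots,y_k)$ of distinct elements of $G$, of size $|Y|=k$ (also identified with its underlying set; any fixed order may be used). The pair $(f,Y)$ is separating if $g\mapsto (f(gy_1),\ldots,f(gy_k))\in[q]^k$ is injective on $G$; $Y$ is separating for $f$ if $(f,Y)$ is separating. For a generating tuple $S$ of distinct nonidentity elements, $\operatorname{Cay}(G,S)$ is the right Cayley graph: vertices are the elements of $G$, with an edge from $g$ to $gs$ for each $s\in S$. A pattern $Y\subseteq G$ is a Cayley window if $1\in Y$, $S\subseteq Y$, and the subgraph of $\operatorname{Cay}(G,S)$ induced by $Y$ is connected (edge orientations forgotten). The connected separating window number is \[ \operatorname{csep}_q(G,S)=\min\{|Y| : Y \text{ is a Cayley window and there exists } f:G\to[q] \text{ with } (f,Y) \text{ separating}\}. \] *)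

theory Defs
  imports
    "HOL-Algebra.Elementary_Groups"
    "HOL-Algebra.Multiplicative_Group"
    "HOL-Library.Extended_Nat"
    "Graph_Theory.Digraph_Component"
begin

definition Z2_group :: "(int \<times> int) monoid" where
  "Z2_group = integer_group \<times>\<times> integer_group"

text \<open>The semidirect product of an abelian group \<open>A\<close> (written multiplicatively) with \<open>C\<^sub>2 = {0, 1}\<close>,
  acting by inversion: \<open>y [^] (-1) ^ e\<close> is the additive \<open>(-1)\<^sup>e y\<close>.\<close>

definition inversion_semidirect :: "('a, 'b) monoid_scheme \<Rightarrow> ('a \<times> nat) monoid" where
  "inversion_semidirect A =
     \<lparr>carrier = carrier A \<times> {0, 1},
      monoid.mult = (\<lambda>(x, e) (y, d). (x \<otimes>\<^bsub>A\<^esub> (y [^]\<^bsub>A\<^esub> ((-1) ^ e :: int)), (e + d) mod 2)),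
      one = (\<one>\<^bsub>A\<^esub>, 0)\<rparr>"

lemma group_inversion_semidirect:
  assumes "comm_group A"
  shows "group (inversion_semidirect A)"
proof -
  interpret A: comm_group A by (fact assms)
  have neg1: "y [^]\<^bsub>A\<^esub> (-1 :: int) = inv\<^bsub>A\<^esub> y" if "y \<in> carrier A" for y
    using that A.int_pow_neg[of y 1] by simp
  show ?thesis
  proof (rule groupI)
    fix x assume "x \<in> carrier (inversion_semidirect A)"
    then obtain a e where x: "x = (a, e)" "a \<in> carrier A" "e = 0 \<or> e = 1"
      by (auto simp: inversion_semidirect_def)
    define y where "y = (if e = 0 then inv\<^bsub>A\<^esub> a else a, e)"
    have "y \<in> carrier (inversion_semidirect A)"
      using x by (auto simp: inversion_semidirect_def y_def)
    moreover have "y \<otimes>\<^bsub>inversion_semidirect A\<^esub> x = \<one>\<^bsub>inversion_semidirect A\<^esub>"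
      using x by (auto simp: inversion_semidirect_def y_def neg1 A.l_inv A.r_inv)
    ultimately show "\<exists>y\<in>carrier (inversion_semidirect A).
        y \<otimes>\<^bsub>inversion_semidirect A\<^esub> x = \<one>\<^bsub>inversion_semidirect A\<^esub>" by blast
  qed (auto simp: inversion_semidirect_def neg1 A.m_ac A.inv_mult)
qed

definition labellings :: "('a, 'b) monoid_scheme \<Rightarrow> nat \<Rightarrow> ('a \<Rightarrow> nat) set" where
  "labellings G q = carrier G \<rightarrow> {0..<q}"

definition is_pattern :: "('a, 'b) monoid_scheme \<Rightarrow> 'a list \<Rightarrow> bool" where
  "is_pattern G Y \<longleftrightarrow> distinct Y \<and> set Y \<subseteq> carrier G"

definition separating :: "('a, 'b) monoid_scheme \<Rightarrow> ('a \<Rightarrow> nat) \<Rightarrow> 'a list \<Rightarrow> bool" where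
  "separating G f Y \<longleftrightarrow> inj_on (\<lambda>g. map (\<lambda>y. f (g \<otimes>\<^bsub>G\<^esub> y)) Y) (carrier G)"

definition Cay :: "('a, 'b) monoid_scheme \<Rightarrow> 'a list \<Rightarrow> ('a, 'a \<times> 'a) pre_digraph" where
  "Cay G S =
     \<lparr>verts = carrier G,
      arcs = {(g, g \<otimes>\<^bsub>G\<^esub> s) | g s. g \<in> carrier G \<and> s \<in> set S},
      tail = fst, head = snd\<rparr>"

text \<open>\<^const>\<open>Digraph_Component.connected\<close> is connectedness of the underlying undirected graph.\<close>

definition cayley_window :: "('a, 'b) monoid_scheme \<Rightarrow> 'a list \<Rightarrow> 'a list \<Rightarrow> bool" where
  "cayley_window G S Y \<longleftrightarrow>
     is_pattern G Y \<and> \<one>\<^bsub>G\<^esub> \<in> set Y \<and> set S \<subseteq> set Y \<and>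
     Digraph_Component.connected (induce_subgraph (Cay G S) (set Y))"

text \<open>The infimum is taken in \<^typ>\<open>enat\<close> so that an empty set of sizes would give \<open>\<infinity>\<close>
  rather than a junk value; for a nonempty set it is the minimum.\<close>

definition csep :: "nat \<Rightarrow> ('a, 'b) monoid_scheme \<Rightarrow> 'a list \<Rightarrow> enat" where
  "csep q G S =
     Inf {enat (length Y) | Y. cayley_window G S Y \<and> (\<exists>f \<in> labellings G q. separating G f Y)}"

end

theory Submission
  imports Defs
begin

text \<open>The word \<open>s\<^sub>1 s\<^sub>2 s\<^sub>1 s\<^sub>2 \<dots>\<close> traces the path
  \<open>1, s\<^sub>1, t, t s\<^sub>1, t\<^sup>2, \<dots>, t\<^sup>k\<^sup>-\<^sup>1\<close> in the Cayley graph; adding \<open>s\<^sub>2\<close> and \<open>s\<^sub>3\<close>, which are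
  neighbours of \<open>1\<close>, keeps the set connected. Enlarging a separating pattern keeps it separating for
  the same labelling, and at most \<open>k + (k - 1) + 2\<close> elements occur.\<close>

lemma comm_group_Z2_group: "comm_group Z2_group"
proof -
  have "group Z2_group"
    unfolding Z2_group_def by (intro DirProd_group group_integer_group)
  then show ?thesis
    by (rule group.group_comm_groupI) (auto simp: Z2_group_def DirProd_def)
qed

text \<open>The values read along \<open>Z\<close> include every value read along \<open>Y\<close>,
  so equal readings on \<open>Z\<close> force equal readings on \<open>Y\<close>. Comparing only
  underlying sets makes the order of enumeration irrelevant.\<close>

lemma separating_mono:
  assumes "separating G f Y" and "set Y \<subseteq> set Z"
  shows "separating G f Z"
  unfolding separating_def
proof (rule inj_onI)
  fix g h
  assume g: "g \<in> carrier G" and h: "h \<in> carrier G"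
    and "map (\<lambda>y. f (g \<otimes>\<^bsub>G\<^esub> y)) Z = map (\<lambda>y. f (h \<otimes>\<^bsub>G\<^esub> y)) Z"
  then have "map (\<lambda>y. f (g \<otimes>\<^bsub>G\<^esub> y)) Y = map (\<lambda>y. f (h \<otimes>\<^bsub>G\<^esub> y)) Y"
    using assms(2) by auto
  with assms(1) g h show "g = h"
    unfolding separating_def by (auto dest: inj_onD)
qed

text \<open>Connectedness is strong connectedness of the symmetric closure, where paths can be
  reversed; any two vertices are thus joined through \<open>r\<close>. The root also supplies the
  required nonempty vertex set.\<close>

lemma connected_if_root_reaches:
  assumes "r \<in> verts H" and "\<And>v. v \<in> verts H \<Longrightarrow> r \<rightarrow>\<^sup>*\<^bsub>mk_symmetric H\<^esub> v"
  shows "Digraph_Component.connected H"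
  unfolding connected_def
proof (rule strongly_connectedI)
  show "verts (mk_symmetric H) \<noteq> {}"
    using assms(1) by auto
next
  fix u v
  assume "u \<in> verts (mk_symmetric H)" "v \<in> verts (mk_symmetric H)"
  then have ru: "r \<rightarrow>\<^sup>*\<^bsub>mk_symmetric H\<^esub> u" and rv: "r \<rightarrow>\<^sup>*\<^bsub>mk_symmetric H\<^esub> v"
    by (simp_all add: assms(2))
  from ru have "u \<rightarrow>\<^sup>*\<^bsub>mk_symmetric H\<^esub> r"
    by (rule symmetric_reachable[OF symmetric_mk_symmetric])
  then show "u \<rightarrow>\<^sup>*\<^bsub>mk_symmetric H\<^esub> v"
    using rv unfolding reachable_def by (rule rtrancl_on_trans)
qed

text \<open>An arc survives in the induced subgraph once both endpoints lie in \<open>Y\<close>, so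
  a path inside \<open>Y\<close> may be prolonged by one generator.\<close>

lemma reachable_Cay_step:
  assumes "r \<rightarrow>\<^sup>*\<^bsub>mk_symmetric (Cay G S \<restriction> Y)\<^esub> x"
    and "x \<in> Y" "x \<in> carrier G" "s \<in> set S" "x \<otimes>\<^bsub>G\<^esub> s \<in> Y"
  shows "r \<rightarrow>\<^sup>*\<^bsub>mk_symmetric (Cay G S \<restriction> Y)\<^esub> (x \<otimes>\<^bsub>G\<^esub> s)"
proof -
  have "(x, x \<otimes>\<^bsub>G\<^esub> s) \<in> parcs (mk_symmetric (Cay G S \<restriction> Y))"
    using assms by (force simp: parcs_mk_symmetric Cay_def)
  with assms show ?thesis
    unfolding reachable_def by (auto intro: rtrancl_on_into_rtrancl_on)
qed

text \<open>Kept as a set because the theorem concerns every list enumerating it.\<close>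

definition zigzag_window :: "('a, 'b) monoid_scheme \<Rightarrow> 'a \<Rightarrow> 'a \<Rightarrow> 'a \<Rightarrow> nat \<Rightarrow> 'a set" where
  "zigzag_window G s1 s2 s3 k =
     {(s1 \<otimes>\<^bsub>G\<^esub> s2) [^]\<^bsub>G\<^esub> j | j. j < k}
     \<union> {(s1 \<otimes>\<^bsub>G\<^esub> s2) [^]\<^bsub>G\<^esub> j \<otimes>\<^bsub>G\<^esub> s1 | j. j \<le> k - 2} \<union> {s1, s2, s3}"

lemma zigzag_window_altdef:
  "zigzag_window G s1 s2 s3 k =
     (\<lambda>j. (s1 \<otimes>\<^bsub>G\<^esub> s2) [^]\<^bsub>G\<^esub> j) ` {..<k}
     \<union> (\<lambda>j. (s1 \<otimes>\<^bsub>G\<^esub> s2) [^]\<^bsub>G\<^esub> j \<otimes>\<^bsub>G\<^esub> s1) ` {..k - 2} \<union> {s1, s2, s3}"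
  unfolding zigzag_window_def by auto

lemma finite_zigzag_window: "finite (zigzag_window G s1 s2 s3 k)"
  by (simp add: zigzag_window_altdef)

context group
begin

text \<open>\<open>s1\<close> is the \<open>j = 0\<close> member of the second family, so only
  \<open>s2\<close> and \<open>s3\<close> come on top of the two families. Coincidences among
  elements can only lower the count, hence an inequality.\<close>

lemma card_zigzag_window:
  assumes "s1 \<in> carrier G" and "2 \<le> k"
  shows "card (zigzag_window G s1 s2 s3 k) \<le> 2 * k + 1"
proof -
  let ?P = "(\<lambda>j. (s1 \<otimes> s2) [^] j) ` {..<k}"
  let ?Q = "(\<lambda>j. (s1 \<otimes> s2) [^] j \<otimes> s1) ` {..k - 2}"
  have "s1 \<in> ?Q"
    using assms by (intro image_eqI[of _ _ 0]) auto
  then have "zigzag_window G s1 s2 s3 k = ?P \<union> ?Q \<union> {s2, s3}"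
    by (auto simp: zigzag_window_altdef)
  also have "card \<dots> \<le> card ?P + card ?Q + card {s2, s3}"
    by (rule order_trans[OF card_Un_le add_right_mono[OF card_Un_le]])
  \<comment> \<open>The range \<open>{..k - 2}\<close> has \<open>k - 1\<close> elements because
    \<open>2 \<le> k\<close>; for smaller \<open>k\<close> the truncated subtraction would break
    this count.\<close>
  also have "\<dots> \<le> k + (k - 1) + 2"
    using card_image_le[of "{..<k}" "\<lambda>j. (s1 \<otimes> s2) [^] j"]
      card_image_le[of "{..k - 2}" "\<lambda>j. (s1 \<otimes> s2) [^] j \<otimes> s1"]
      card_insert_le_m1[of 2 "{s3}" s2] assms(2)
    by (intro add_mono) auto
  finally show ?thesis
    using assms(2) by simp
qed

lemma zigzag_window_subset_carrier:
  assumes "s1 \<in> carrier G" "s2 \<in> carrier G" "s3 \<in> carrier G"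
  shows "zigzag_window G s1 s2 s3 k \<subseteq> carrier G"
  using assms by (auto simp: zigzag_window_def)

lemma connected_zigzag_window:
  assumes S: "s1 \<in> carrier G" "s2 \<in> carrier G" "s3 \<in> carrier G" and k: "2 \<le> k"
  shows "Digraph_Component.connected
    (Cay G [s1, s2, s3] \<restriction> zigzag_window G s1 s2 s3 k)"
proof -
  let ?W = "zigzag_window G s1 s2 s3 k"
  let ?H = "Cay G [s1, s2, s3] \<restriction> ?W"
  define t where "t = s1 \<otimes> s2"
  have t: "t \<in> carrier G"
    using S by (simp add: t_def)
  have pow_in: "t [^] j \<in> ?W" if "j < k" for j :: nat
    using that by (auto simp: zigzag_window_def t_def)
  have pow_s1_in: "t [^] j \<otimes> s1 \<in> ?W" if "j \<le> k - 2" for j :: nat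
    using that by (auto simp: zigzag_window_def t_def)
  have one_in: "\<one> \<in> ?W"
    using pow_in[of 0] k by simp
  note step = reachable_Cay_step[where G = G and S = "[s1, s2, s3]" and Y = ?W]
  have refl: "\<one> \<rightarrow>\<^sup>*\<^bsub>mk_symmetric ?H\<^esub> \<one>"
    using one_in by (simp add: reachable_def)
  have gen: "\<one> \<rightarrow>\<^sup>*\<^bsub>mk_symmetric ?H\<^esub> s" if "s \<in> {s1, s2, s3}" for s
  proof -
    have "s \<in> carrier G" "s \<in> ?W"
      using that S by (auto simp: zigzag_window_def)
    then show ?thesis
      using step[OF refl one_in, of s] that by simp
  qed
  \<comment> \<open>Conditional on \<open>t [^] j\<close> being reachable, so that it can serve
    inside the induction proving \<open>pow\<close>.\<close>
  have pow_s1: "\<one> \<rightarrow>\<^sup>*\<^bsub>mk_symmetric ?H\<^esub> (t [^] j \<otimes> s1)"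
    if "\<one> \<rightarrow>\<^sup>*\<^bsub>mk_symmetric ?H\<^esub> (t [^] j)" "j \<le> k - 2" for j :: nat
    using step[OF that(1), of s1] that(2) k t pow_in pow_s1_in by simp
  have pow: "\<one> \<rightarrow>\<^sup>*\<^bsub>mk_symmetric ?H\<^esub> (t [^] j)" if "j < k" for j :: nat
    using that
  proof (induction j)
    case 0
    then show ?case using refl by simp
  next
    case (Suc j)
    \<comment> \<open>The bound \<open>Suc j < k\<close> is exactly what puts the intermediate
      vertex \<open>t [^] j \<otimes> s1\<close> in the window.\<close>
    then have j: "j \<le> k - 2" by simp
    have eq: "t [^] j \<otimes> s1 \<otimes> s2 = t [^] Suc j"
      using S t by (simp add: t_def m_assoc)
    have "\<one> \<rightarrow>\<^sup>*\<^bsub>mk_symmetric ?H\<^esub> (t [^] j \<otimes> s1 \<otimes> s2)"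
    proof (rule step)
      show "\<one> \<rightarrow>\<^sup>*\<^bsub>mk_symmetric ?H\<^esub> (t [^] j \<otimes> s1)"
        using Suc j by (intro pow_s1) auto
      show "t [^] j \<otimes> s1 \<otimes> s2 \<in> ?W"
        unfolding eq using Suc.prems by (rule pow_in)
    qed (use S t j pow_s1_in in auto)
    then show ?case by (simp only: eq)
  qed
  show ?thesis
  proof (rule connected_if_root_reaches)
    show "\<one> \<in> verts ?H"
      using one_in by simp
  next
    fix v assume "v \<in> verts ?H"
    then consider j :: nat where "j < k" "v = t [^] j"
      | j :: nat where "j \<le> k - 2" "v = t [^] j \<otimes> s1" | "v \<in> {s1, s2, s3}"
      by (auto simp: zigzag_window_def t_def)
    then show "\<one> \<rightarrow>\<^sup>*\<^bsub>mk_symmetric ?H\<^esub> v"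
    proof cases
      case 2
      then show ?thesis using k by (auto intro!: pow_s1 pow)
    qed (auto intro: pow gen)
  qed
qed

lemma cayley_window_zigzag:
  assumes "s1 \<in> carrier G" "s2 \<in> carrier G" "s3 \<in> carrier G" and k: "2 \<le> k"
    and Y: "distinct Y" "set Y = zigzag_window G s1 s2 s3 k"
  shows "cayley_window G [s1, s2, s3] Y"
proof -
  \<comment> \<open>The identity enters the window as the power with exponent 0.\<close>
  have "0 < k"
    using k by simp
  then have "(s1 \<otimes> s2) [^] (0 :: nat) \<in> zigzag_window G s1 s2 s3 k"
    unfolding zigzag_window_def by blast
  then have one: "\<one> \<in> set Y"
    by (simp add: Y(2))
  have "set [s1, s2, s3] \<subseteq> set Y"
    unfolding Y(2) by (simp add: zigzag_window_def)
  with one show ?thesis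
    using Y(1) connected_zigzag_window[OF assms(1-4)]
      zigzag_window_subset_carrier[OF assms(1-3), of k]
    unfolding cayley_window_def is_pattern_def Y(2) by blast
qed

end

theorem proposition6p3:
  fixes N :: "(int \<times> int) set"
    and A :: "(int \<times> int) set monoid"
    and G :: "((int \<times> int) set \<times> nat) monoid"
    and v1 v2 :: "(int \<times> int) set"
    and s1 s2 s3 t :: "(int \<times> int) set \<times> nat"
    and m k q :: nat
  assumes "subgroup N Z2_group"
    and "finite (rcosets\<^bsub>Z2_group\<^esub> N)"
    and "A = Z2_group Mod N"
    and "G = inversion_semidirect A"
    and "v1 = N #>\<^bsub>Z2_group\<^esub> (1, 0)"
    and "v2 = N #>\<^bsub>Z2_group\<^esub> (0, 1)"
    and "distinct [s1, s2, s3]"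
    and "set [s1, s2, s3] = {(v1, 1), (v1 \<otimes>\<^bsub>A\<^esub> v2, 1), (v2, 1)}"
    and "t = s1 \<otimes>\<^bsub>G\<^esub> s2"
    and "m = group.ord G t"
    and "2 \<le> k" and "k \<le> m"
    and "2 \<le> q"
    and "\<exists>f \<in> labellings G q. separating G f (map (\<lambda>j. t [^]\<^bsub>G\<^esub> j) [0..<k])"
  shows "(\<forall>Y. distinct Y \<and>
            set Y = {t [^]\<^bsub>G\<^esub> j | j. j < k} \<union> {t [^]\<^bsub>G\<^esub> j \<otimes>\<^bsub>G\<^esub> s1 | j. j \<le> k - 2}
              \<union> {s1, s2, s3} \<longrightarrow>
            cayley_window G [s1, s2, s3] Y \<and> (\<exists>f \<in> labellings G q. separating G f Y))
         \<and> csep q G [s1, s2, s3] \<le> enat (2 * k + 1)"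
proof -
  let ?W = "zigzag_window G s1 s2 s3 k"
  have "comm_group A"
    unfolding assms(3)
    by (rule comm_group.abelian_FactGroup[OF comm_group_Z2_group assms(1)])
  then interpret A: comm_group A .
  interpret group G
    unfolding assms(4) by (rule group_inversion_semidirect) fact
  have v: "v1 \<in> carrier A" "v2 \<in> carrier A"
    unfolding assms(3,5,6) by (auto simp: FactGroup_def RCOSETS_def Z2_group_def)
  \<comment> \<open>The order of the generators is unspecified, so membership is derived for the
    whole set at once.\<close>
  have "set [s1, s2, s3] \<subseteq> carrier G"
    unfolding assms(8) using v by (auto simp: assms(4) inversion_semidirect_def)
  then have S: "s1 \<in> carrier G" "s2 \<in> carrier G" "s3 \<in> carrier G"
    by auto
  obtain f where f: "f \<in> labellings G q"
      "separating G f (map (\<lambda>j. t [^]\<^bsub>G\<^esub> j) [0..<k])"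
    using assms(14) by blast
  \<comment> \<open>Stated for every enumeration: this is the first conclusion, and one instance of
    it bounds \<open>csep\<close>.\<close>
  have window: "cayley_window G [s1, s2, s3] Y \<and> (\<exists>f \<in> labellings G q. separating G f Y)"
    if "distinct Y" "set Y = ?W" for Y
  proof
    show "cayley_window G [s1, s2, s3] Y"
      using S \<open>2 \<le> k\<close> that by (rule cayley_window_zigzag)
    have "set (map (\<lambda>j. t [^]\<^bsub>G\<^esub> j) [0..<k]) \<subseteq> set Y"
      unfolding that by (auto simp: zigzag_window_def assms(9))
    with f(2) have "separating G f Y"
      by (rule separating_mono)
    then show "\<exists>f \<in> labellings G q. separating G f Y"
      using f(1) by (rule bexI)
  qed
  \<comment> \<open>\<open>csep\<close> is an infimum over lengths of lists, so a repetition-free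
    enumeration is chosen; its length is the cardinality of the window.\<close>
  obtain Y where Y: "set Y = ?W" "distinct Y"
    using finite_distinct_list[OF finite_zigzag_window[of G s1 s2 s3 k]] by (elim exE conjE)
  have "csep q G [s1, s2, s3] \<le> enat (length Y)"
    unfolding csep_def using window[OF Y(2,1)]
    by (intro Inf_lower CollectI exI[of _ Y] conjI refl; elim conjE)
  also have "\<dots> \<le> enat (2 * k + 1)"
    using card_zigzag_window[OF S(1) \<open>2 \<le> k\<close>, of s2 s3]
    by (simp add: Y(1) flip: distinct_card[OF Y(2)])
  finally show ?thesis
    using window unfolding zigzag_window_def assms(9) by simp
qed

end
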